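(* Let $(\Omega,\mathcal{F})$ be a measurable space and let $\mathcal{P}$ and $\mathcal{Q}$ be non-empty convex sets of probability measures on $(\Omega,\mathcal{F})$ such that $\mathcal{Q}\lll\mathcal{P}$. Assume that $l(\mathbb{L}^{\infty})=E'$. Assume that for some fixed $\varepsilon>0$ and $\delta>0$ the following holds: for each $A\in\mathcal{F}$ such that there exists $P\in\mathcal{P}$ with $P(A)\geq\varepsilon$, there exists $Q\in\mathcal{Q}$ with $Q(A)\geq\delta$. Then for each $P\in\mathcal{P}$ there exists $Q\in\mathcal{Q}$ such that for each $A\in\mathcal{F}$ with $P(A)\geq 2\varepsilon$ we have $Q(A)\geq\frac{\varepsilon\delta}{2}$.
   Context: For sets $\mathcal{R},\mathcal{P}$ of probability measures on $(\Omega,\mathcal{F})$, $\mathcal{R}\lll\mathcal{P}$ means that for every $R\in\mathcal{R}$ there exists $P\in\mathcal{P}$ with $R\ll P$. A set $A'\subset\Omega$ is $\mathcal{P}$-polar if $A'\subset A$ for some $A\in\mathcal{F}$ with $P(A)=0$ for all $P\in\mathcal{P}$; a property holds $\mathcal{P}$-quasi-surely ($\mathcal{P}$-q.s.) if it holds outside a $\mathcal{P}$-polar set. $\mathcal{L}^\infty$ is the set of $\mathcal{F}$-measurable $X:\Omega\to\mathbb{R}$ for which there is a constant $M$ with $|X|\le M$ $\mathcal{P}$-q.s.; $\mathbb{L}^{\infty}=\mathcal{L}^\infty/\mathcal{N}$, where $\mathcal{N}$ is the set of measurable functions equal to $0$ $\mathcal{P}$-q.s.; the norm is $\|X\|_{\mathbb{L}^\infty}=\inf\{M\ge0:|X|\le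 M\ \mathcal{P}\text{-q.s.}\}$. $E$ is the space of all finite signed measures on $\mathcal{F}$ that are absolutely continuous with respect to at least one $P\in\mathcal{P}$, equipped with the total variation norm; $E'$ is its (topological) dual. The map $l:\mathbb{L}^\infty\to E'$, $h\mapsto l_h$, is given by $l_h(\mu)=\int_\Omega h\,d\mu$ for $\mu\in E$, and $l(\mathbb{L}^\infty)$ is its image. *)

theory Defs
  imports "HOL-Probability.Probability"
begin

text \<open>
  A measurable space is given by a measure \<open>M\<close> of which only \<open>space M\<close> and \<open>sets M\<close>
  are used. The probability measures on it are the elements of
  \<open>space (prob_algebra M)\<close>.
\<close>

definition mixture :: "real \<Rightarrow> 'a measure \<Rightarrow> 'a measure \<Rightarrow> 'a measure" where
  "mixture t p q = measure_of (space p) (sets p)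
     (\<lambda>A. ennreal t * emeasure p A + ennreal (1 - t) * emeasure q A)"

definition convex_measures :: "'a measure set \<Rightarrow> bool" where
  "convex_measures P \<longleftrightarrow> (\<forall>p\<in>P. \<forall>q\<in>P. \<forall>t\<in>{0..1}. mixture t p q \<in> P)"

text \<open>The relation written \<open>R \<lll> P\<close>; note the argument order of the library's
  \<^const>\<open>absolutely_continuous\<close>, where \<open>absolutely_continuous p r\<close> means \<open>r \<lless> p\<close>.\<close>

definition dominated_by :: "'a measure set \<Rightarrow> 'a measure set \<Rightarrow> bool" where
  "dominated_by R P \<longleftrightarrow> (\<forall>r\<in>R. \<exists>p\<in>P. absolutely_continuous p r)"

definition polar :: "'a measure \<Rightarrow> 'a measure set \<Rightarrow> 'a set \<Rightarrow> bool" where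
  "polar M P S \<longleftrightarrow> (\<exists>A\<in>sets M. S \<subseteq> A \<and> (\<forall>p\<in>P. emeasure p A = 0))"

definition holds_qs :: "'a measure \<Rightarrow> 'a measure set \<Rightarrow> ('a \<Rightarrow> bool) \<Rightarrow> bool" where
  "holds_qs M P \<phi> \<longleftrightarrow> polar M P {x \<in> space M. \<not> \<phi> x}"

definition Linf_fun :: "'a measure \<Rightarrow> 'a measure set \<Rightarrow> ('a \<Rightarrow> real) set" where
  "Linf_fun M P = {X \<in> borel_measurable M. \<exists>C. holds_qs M P (\<lambda>x. \<bar>X x\<bar> \<le> C)}"

definition null_fun :: "'a measure \<Rightarrow> 'a measure set \<Rightarrow> ('a \<Rightarrow> real) set" where
  "null_fun M P = {X \<in> borel_measurable M. holds_qs M P (\<lambda>x. X x = 0)}"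

definition Linf_rel :: "'a measure \<Rightarrow> 'a measure set \<Rightarrow> (('a \<Rightarrow> real) \<times> ('a \<Rightarrow> real)) set" where
  "Linf_rel M P = {(X, Y). X \<in> Linf_fun M P \<and> Y \<in> Linf_fun M P \<and> (\<lambda>x. X x - Y x) \<in> null_fun M P}"

definition Linf :: "'a measure \<Rightarrow> 'a measure set \<Rightarrow> ('a \<Rightarrow> real) set set" where
  "Linf M P = Linf_fun M P // Linf_rel M P"

text \<open>Signed measures are set functions on \<open>sets M\<close>. They are set to 0 outside \<open>sets M\<close>,
  so that equality of signed measures is equality of functions and the vector space operations
  are pointwise. Countable additivity forces the value 0 on the empty set.\<close>

definition signed_measures :: "'a measure \<Rightarrow> ('a set \<Rightarrow> real) set" where
  "signed_measures M = {\<mu>. (\<forall>A. A \<notin> sets M \<longrightarrow> \<mu> A = 0) \<and>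
     (\<forall>D :: nat \<Rightarrow> 'a set. range D \<subseteq> sets M \<longrightarrow> disjoint_family D \<longrightarrow>
        (\<lambda>n. \<mu> (D n)) sums \<mu> (\<Union>n. D n))}"

text \<open>The total variation of \<open>\<mu>\<close> over \<open>space M\<close>. It is a supremum in the reals because a finite
  signed measure has finite variation.\<close>

definition tv_norm :: "'a measure \<Rightarrow> ('a set \<Rightarrow> real) \<Rightarrow> real" where
  "tv_norm M \<mu> = (SUP C\<in>{C. finite C \<and> C \<subseteq> sets M \<and> disjoint C \<and> \<Union>C = space M}. \<Sum>A\<in>C. \<bar>\<mu> A\<bar>)"

definition signed_ac :: "'a measure \<Rightarrow> ('a set \<Rightarrow> real) \<Rightarrow> bool" where
  "signed_ac p \<mu> \<longleftrightarrow> (\<forall>A\<in>null_sets p. \<mu> A = 0)"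

definition E_space :: "'a measure \<Rightarrow> 'a measure set \<Rightarrow> ('a set \<Rightarrow> real) set" where
  "E_space M P = {\<mu> \<in> signed_measures M. \<exists>p\<in>P. signed_ac p \<mu>}"

text \<open>The positive part in the Jordan decomposition. On \<open>sets M\<close> it is given by
  \<open>A \<mapsto> sup {\<mu> B | B \<in> sets M, B \<subseteq> A}\<close>; as \<^const>\<open>ennreal\<close> sends negative reals to 0
  and \<open>\<mu> {} = 0\<close>, the coercion does not change this supremum. The negative part is the
  positive part of \<open>- \<mu>\<close>.\<close>

definition pos_part :: "'a measure \<Rightarrow> ('a set \<Rightarrow> real) \<Rightarrow> 'a measure" where
  "pos_part M \<mu> = measure_of (space M) (sets M)
     (\<lambda>A. SUP B\<in>{B \<in> sets M. B \<subseteq> A}. ennreal (\<mu> B))"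

definition signed_integral :: "'a measure \<Rightarrow> ('a set \<Rightarrow> real) \<Rightarrow> ('a \<Rightarrow> real) \<Rightarrow> real" where
  "signed_integral M \<mu> h =
     integral\<^sup>L (pos_part M \<mu>) h - integral\<^sup>L (pos_part M (\<lambda>A. - \<mu> A)) h"

text \<open>Functionals on \<^const>\<open>E_space\<close> are made extensional, so that equality of functionals
  is equality on \<^const>\<open>E_space\<close>. The continuity condition is continuity on all of
  \<^const>\<open>E_space\<close> with respect to the total variation norm.\<close>

definition E_dual :: "'a measure \<Rightarrow> 'a measure set \<Rightarrow> (('a set \<Rightarrow> real) \<Rightarrow> real) set" where
  "E_dual M P = {\<phi> \<in> extensional (E_space M P).
     (\<forall>\<mu>\<in>E_space M P. \<forall>\<nu>\<in>E_space M P. \<phi> (\<lambda>A. \<mu> A + \<nu> A) = \<phi> \<mu> + \<phi> \<nu>) \<and>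
     (\<forall>c. \<forall>\<mu>\<in>E_space M P. \<phi> (\<lambda>A. c * \<mu> A) = c * \<phi> \<mu>) \<and>
     (\<forall>\<mu>\<in>E_space M P. \<forall>e>0. \<exists>d>0. \<forall>\<nu>\<in>E_space M P.
        tv_norm M (\<lambda>A. \<nu> A - \<mu> A) < d \<longrightarrow> \<bar>\<phi> \<nu> - \<phi> \<mu>\<bar> < e)}"

definition l_fun :: "'a measure \<Rightarrow> 'a measure set \<Rightarrow> ('a \<Rightarrow> real) \<Rightarrow> ('a set \<Rightarrow> real) \<Rightarrow> real" where
  "l_fun M P h = (\<lambda>\<mu>\<in>E_space M P. signed_integral M \<mu> h)"

text \<open>The map induced on equivalence classes; \<^const>\<open>l_fun\<close> is constant on each class
  (lemma \<open>l_map_class\<close> below).\<close>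

definition l_map :: "'a measure \<Rightarrow> 'a measure set \<Rightarrow> ('a \<Rightarrow> real) set \<Rightarrow> ('a set \<Rightarrow> real) \<Rightarrow> real" where
  "l_map M P c = the_elem (l_fun M P ` c)"

lemma sets_pos_part [simp]: "sets (pos_part M \<mu>) = sets M"
  by (simp add: pos_part_def)

lemma space_pos_part [simp]: "space (pos_part M \<mu>) = space M"
  by (simp add: pos_part_def)

lemma pos_part_null:
  assumes A: "A \<in> sets M" and 0: "\<And>B. B \<in> sets M \<Longrightarrow> B \<subseteq> A \<Longrightarrow> \<mu> B = 0"
  shows "A \<in> null_sets (pos_part M \<mu>)"
proof -
  have "(SUP B\<in>{B \<in> sets M. B \<subseteq> A}. ennreal (\<mu> B)) = (0::ennreal)"
    using A 0 by (intro antisym SUP_least) auto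
  then have "emeasure (pos_part M \<mu>) A = 0"
    unfolding pos_part_def emeasure_measure_of_conv by (auto split: if_splits)
  with A show ?thesis by auto
qed

lemma l_fun_cong:
  assumes P: "P \<subseteq> space (prob_algebra M)" and XY: "(X, Y) \<in> Linf_rel M P"
  shows "l_fun M P X = l_fun M P Y"
proof -
  have m: "X \<in> borel_measurable M" "Y \<in> borel_measurable M"
    using XY by (auto simp: Linf_rel_def Linf_fun_def)
  obtain N where N: "N \<in> sets M" "{x \<in> space M. X x - Y x \<noteq> 0} \<subseteq> N"
      "\<And>p. p \<in> P \<Longrightarrow> emeasure p N = 0"
    using XY by (auto simp: Linf_rel_def null_fun_def holds_qs_def polar_def)
  have "signed_integral M \<mu> X = signed_integral M \<mu> Y" if "\<mu> \<in> E_space M P" for \<mu>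
  proof -
    from that obtain p where p: "p \<in> P" "signed_ac p \<mu>" by (auto simp: E_space_def)
    from p P have s: "sets p = sets M" by (auto simp: space_prob_algebra)
    have z: "\<mu> B = 0" if "B \<in> sets M" "B \<subseteq> N" for B
    proof -
      have "emeasure p B \<le> emeasure p N" using N(1) that s by (intro emeasure_mono) auto
      then have "B \<in> null_sets p" using N(3)[OF p(1)] that s by auto
      then show ?thesis using p by (auto simp: signed_ac_def)
    qed
    have *: "integral\<^sup>L (pos_part M \<nu>) X = integral\<^sup>L (pos_part M \<nu>) Y"
      if "N \<in> null_sets (pos_part M \<nu>)" for \<nu>
    proof (rule integral_cong_AE)
      show "AE x in pos_part M \<nu>. X x = Y x"
        by (rule AE_I'[OF that]) (use N(2) in auto)
    qed (use m in \<open>auto cong: measurable_cong_sets\<close>)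
    show ?thesis
      unfolding signed_integral_def using z N(1) by (simp add: * pos_part_null)
  qed
  then show ?thesis by (auto simp: l_fun_def restrict_def)
qed

lemma l_map_class:
  assumes P: "P \<subseteq> space (prob_algebra M)" and X: "X \<in> Linf_fun M P"
  shows "l_map M P (Linf_rel M P `` {X}) = l_fun M P X"
proof -
  have "polar M P {}" by (auto simp: polar_def intro!: bexI[of _ "{}"])
  then have "(X, X) \<in> Linf_rel M P"
    using X by (auto simp: Linf_rel_def null_fun_def holds_qs_def)
  moreover have "l_fun M P Y = l_fun M P X" if "(X, Y) \<in> Linf_rel M P" for Y
    using l_fun_cong[OF P that] by simp
  ultimately have "l_fun M P ` (Linf_rel M P `` {X}) = {l_fun M P X}"
    by blast
  then show ?thesis by (simp add: l_map_def)
qed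

end

theory Submission
  imports Defs
begin

text \<open>
  Fix \<open>p\<close> and let \<open>K\<close> be the set of all \<open>h\<close> with \<open>0 \<le> h \<le> 1\<close> and
  \<open>\<integral>h dp \<ge> 2\<epsilon>\<close>, viewed in the dual of \<open>E\<close>. For \<open>h \<in> K\<close> the set \<open>A = {h \<ge> \<epsilon>}\<close> has
  \<open>p A \<ge> \<epsilon>\<close>, so some \<open>q \<in> Q\<close> has \<open>q A \<ge> \<delta>\<close>, whence \<open>\<integral>h dq \<ge> \<epsilon>\<delta>\<close>. Since \<open>l\<close> is onto, \<open>K\<close> is
  compact for pointwise convergence on \<open>E\<close>, so finitely many \<open>q\<close> suffice to get
  \<open>\<integral>h dq > \<epsilon>\<delta>/2\<close> for one of them, whatever \<open>h \<in> K\<close>. Convexity of \<open>K\<close> and a finite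
  minimax argument then give a single mixture \<open>q\<close> with \<open>\<integral>h dq \<ge> \<epsilon>\<delta>/2\<close> for all
  \<open>h \<in> K\<close>; take for \<open>h\<close> the indicators.
\<close>

section \<open>Separation in the plane and a finite minimax argument\<close>

text \<open>The hypothesis says that \<open>C\<close> misses the open quadrant of points with both
  coordinates below \<open>a\<close>. A separating normal has nonnegative components because the
  quadrant is unbounded below; dividing by their sum gives the weight \<open>t\<close>.\<close>

lemma convex_pair_separation:
  fixes C :: "(real \<times> real) set"
  assumes "convex C" and ge: "\<And>u v. (u, v) \<in> C \<Longrightarrow> a \<le> u \<or> a \<le> v"
  shows "\<exists>t\<in>{0..1}. \<forall>(u, v)\<in>C. a \<le> t * u + (1 - t) * v"
proof (cases "C = {}")
  case False
  let ?D = "{..<a} \<times> {..<a}"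
  have "convex ?D" by (intro convex_Times) auto
  moreover have "?D \<noteq> {}" by (auto intro: lt_ex)
  moreover have "?D \<inter> C = {}" using ge by fastforce
  ultimately obtain n b where n: "n \<noteq> 0" and D: "\<And>x. x \<in> ?D \<Longrightarrow> n \<bullet> x \<le> b"
      and C: "\<And>x. x \<in> C \<Longrightarrow> b \<le> n \<bullet> x"
    using separating_hyperplane_sets[of ?D C] \<open>convex C\<close> False by blast
  define \<alpha> \<beta> where ab: "\<alpha> = fst n" "\<beta> = snd n"
  have n_eq: "n = (\<alpha>, \<beta>)" by (simp add: ab)
  have le: "\<alpha> * (a - s) + \<beta> * (a - r) \<le> b" if "s > 0" "r > 0" for s r
    using D[of "(a - s, a - r)"] that by (simp add: n_eq)
  \<comment> \<open>A linear function bounded above on the positive half-line has slope at most 0: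
    for negative \<open>x\<close>, the witness would give it the value
    \<open>\<bar>c\<bar> + 1\<close>, above \<open>c\<close>.\<close>
  have nonneg: "0 \<le> x" if "\<And>s. s > 0 \<Longrightarrow> - x * s \<le> c" for x c :: real
  proof (rule ccontr)
    assume "\<not> 0 \<le> x"
    then have "- x * ((\<bar>c\<bar> + 1) / (- x)) = \<bar>c\<bar> + 1" "(\<bar>c\<bar> + 1) / (- x) > 0"
      by (simp_all add: divide_neg_neg divide_pos_neg)
    with that[of "(\<bar>c\<bar> + 1) / (- x)"] show False by linarith
  qed
  have "\<alpha> \<ge> 0"
    by (rule nonneg[of _ "b - \<alpha> * a - \<beta> * (a - 1)"]) (use le[of _ 1] in \<open>simp add: algebra_simps\<close>)
  moreover have "\<beta> \<ge> 0"
    by (rule nonneg[of _ "b - \<beta> * a - \<alpha> * (a - 1)"]) (use le[of 1] in \<open>simp add: algebra_simps\<close>)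
  ultimately have pos: "\<alpha> \<ge> 0" "\<beta> \<ge> 0" "\<alpha> + \<beta> > 0"
    using n by (auto simp: n_eq zero_prod_def)
  \<comment> \<open>The corner \<open>(a, a)\<close> is not in the open quadrant, so it is
    approached from inside; the chosen shift costs exactly \<open>e\<close>.\<close>
  have "(\<alpha> + \<beta>) * a \<le> b"
  proof (rule field_le_epsilon)
    fix e :: real assume "e > 0"
    then have "(\<alpha> + \<beta>) * (a - e / (\<alpha> + \<beta>)) \<le> b"
      using le[of "e / (\<alpha> + \<beta>)" "e / (\<alpha> + \<beta>)"] pos by (simp add: distrib_right)
    moreover have "(\<alpha> + \<beta>) * (a - e / (\<alpha> + \<beta>)) = (\<alpha> + \<beta>) * a - e"
      using pos by (simp add: right_diff_distrib)
    ultimately show "(\<alpha> + \<beta>) * a \<le> b + e" by simp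
  qed
  define t where "t = \<alpha> / (\<alpha> + \<beta>)"
  have "1 - t = \<beta> / (\<alpha> + \<beta>)" using pos by (simp add: t_def field_simps)
  have "a \<le> t * u + (1 - t) * v" if "(u, v) \<in> C" for u v
  proof -
    have "(\<alpha> + \<beta>) * a \<le> \<alpha> * u + \<beta> * v"
      using C[OF that] \<open>(\<alpha> + \<beta>) * a \<le> b\<close> by (simp add: n_eq)
    then have "a \<le> (\<alpha> * u + \<beta> * v) / (\<alpha> + \<beta>)"
      using pos by (simp add: pos_le_divide_eq mult.commute)
    then show ?thesis
      unfolding \<open>1 - t = _\<close> by (simp add: t_def add_divide_distrib)
  qed
  moreover have "t \<in> {0..1}" using pos by (simp add: t_def)
  ultimately show ?thesis by blast
qed (auto intro!: bexI[of _ 0])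

text \<open>Induction on \<open>F\<close>: the functions of \<open>X\<close> that fail at
  \<open>i\<close> admit a common \<open>q\<close> by the induction hypothesis. Every function of
  \<open>X\<close> is then at least \<open>a\<close> at \<open>i\<close> or at \<open>q\<close>, and
  the planar lemma tells how to mix these two points. \<open>X\<close> must be arbitrary because it
  shrinks in the step.\<close>

lemma finite_minimax:
  fixes X :: "('b \<Rightarrow> real) set" and S :: "'b set"
  assumes "finite F" "F \<noteq> {}" "F \<subseteq> S"
    and "\<And>\<phi> \<psi> t. \<phi> \<in> X \<Longrightarrow> \<psi> \<in> X \<Longrightarrow> t \<in> {0..1} \<Longrightarrow> (\<lambda>s. t * \<phi> s + (1 - t) * \<psi> s) \<in> X"
    and mix: "\<And>p q t. p \<in> S \<Longrightarrow> q \<in> S \<Longrightarrow> t \<in> {0..1} \<Longrightarrow>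
      \<exists>r\<in>S. \<forall>\<phi>\<in>X. \<phi> r = t * \<phi> p + (1 - t) * \<phi> q"
    and "\<And>\<phi>. \<phi> \<in> X \<Longrightarrow> \<exists>q\<in>F. a \<le> \<phi> q"
  shows "\<exists>q\<in>S. \<forall>\<phi>\<in>X. a \<le> \<phi> q"
  using assms
proof (induction F arbitrary: X rule: finite_ne_induct)
  case (singleton q)
  show ?case using singleton(1) singleton(4) by (intro bexI[of _ q]) auto
next
  case (insert i F)
  \<comment> \<open>The strict inequality survives convex combinations, and it rules out
    \<open>i\<close> as the point supplied by the last hypothesis, so that a point of
    \<open>F\<close> remains.\<close>
  define Y where "Y = {\<phi>\<in>X. \<phi> i < a}"
  have "\<exists>q\<in>S. \<forall>\<phi>\<in>Y. a \<le> \<phi> q"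
  proof (rule insert.IH)
    fix \<phi> \<psi> :: "'b \<Rightarrow> real" and t :: real
    assume *: "\<phi> \<in> Y" "\<psi> \<in> Y" "t \<in> {0..1}"
    then have "t * \<phi> i + (1 - t) * \<psi> i < a"
      by (intro convex_bound_lt) (auto simp: Y_def)
    with * insert.prems(2) show "(\<lambda>s. t * \<phi> s + (1 - t) * \<psi> s) \<in> Y"
      by (simp add: Y_def)
  next
    fix p q and t :: real
    assume "p \<in> S" "q \<in> S" "t \<in> {0..1}"
    then show "\<exists>r\<in>S. \<forall>\<phi>\<in>Y. \<phi> r = t * \<phi> p + (1 - t) * \<phi> q"
      using insert.prems(3)[of p q t] by (auto simp: Y_def)
  next
    fix \<phi> assume "\<phi> \<in> Y"
    then show "\<exists>q\<in>F. a \<le> \<phi> q"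
      using insert.prems(4)[of \<phi>] by (auto simp: Y_def)
  qed (use insert.prems in auto)
  then obtain q where q: "q \<in> S" "\<And>\<phi>. \<phi> \<in> Y \<Longrightarrow> a \<le> \<phi> q" by blast
  have "\<exists>t\<in>{0..1}. \<forall>(u, v)\<in>(\<lambda>\<phi>. (\<phi> i, \<phi> q)) ` X. a \<le> t * u + (1 - t) * v"
  proof (rule convex_pair_separation)
    show "convex ((\<lambda>\<phi>. (\<phi> i, \<phi> q)) ` X)"
    proof (rule convexI, safe)
      fix \<phi> \<psi> :: "'b \<Rightarrow> real" and u v :: real
      assume *: "\<phi> \<in> X" "\<psi> \<in> X" "0 \<le> u" "0 \<le> v" "u + v = 1"
      then have v: "v = 1 - u" by linarith
      have "(\<lambda>s. u * \<phi> s + v * \<psi> s) \<in> X"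
        unfolding v using * by (intro insert.prems(2)) auto
      then show "u *\<^sub>R (\<phi> i, \<phi> q) + v *\<^sub>R (\<psi> i, \<psi> q) \<in> (\<lambda>\<phi>. (\<phi> i, \<phi> q)) ` X"
        by (intro rev_image_eqI) auto
    qed
    show "a \<le> u \<or> a \<le> v" if "(u, v) \<in> (\<lambda>\<phi>. (\<phi> i, \<phi> q)) ` X" for u v
      using that q(2) by (force simp: Y_def)
  qed
  then obtain t where t: "t \<in> {0..1}" "\<And>\<phi>. \<phi> \<in> X \<Longrightarrow> a \<le> t * \<phi> i + (1 - t) * \<phi> q" by auto
  obtain r where "r \<in> S" "\<forall>\<phi>\<in>X. \<phi> r = t * \<phi> i + (1 - t) * \<phi> q"
    using insert.prems(1,3) q(1) t(1) by blast
  with t(2) show ?case by auto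
qed

section \<open>Finite signed measures and total variation\<close>

lemma signed_measures_sums:
  fixes D :: "nat \<Rightarrow> 'a set"
  assumes "\<mu> \<in> signed_measures M" "range D \<subseteq> sets M" "disjoint_family D"
  shows "(\<lambda>n. \<mu> (D n)) sums \<mu> (\<Union>n. D n)"
  using assms unfolding signed_measures_def by blast

lemma signed_measures_empty:
  assumes "\<mu> \<in> signed_measures M"
  shows "\<mu> {} = 0"
proof -
  have "(\<lambda>n::nat. \<mu> {}) sums \<mu> (\<Union>n::nat. {})"
    by (rule signed_measures_sums[OF assms]) (auto simp: disjoint_family_on_def)
  then show ?thesis using sums_summable summable_const_iff by blast
qed

lemma signed_measures_Un:
  assumes "\<mu> \<in> signed_measures M" "A \<in> sets M" "B \<in> sets M" "A \<inter> B = {}"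
  shows "\<mu> (A \<union> B) = \<mu> A + \<mu> B"
proof -
  have "disjoint_family (binaryset A B)"
    using assms(4) by (auto simp: disjoint_family_on_def binaryset_def)
  moreover have "range (binaryset A B) \<subseteq> sets M"
    using assms(2,3) by (simp add: range_binaryset_eq)
  ultimately have "(\<lambda>n. \<mu> (binaryset A B n)) sums \<mu> (\<Union>n. binaryset A B n)"
    by (intro signed_measures_sums[OF assms(1)])
  moreover have "(\<lambda>n. \<mu> (binaryset A B n)) sums (\<mu> A + \<mu> B)"
    by (rule binaryset_sums) (rule signed_measures_empty[OF assms(1)])
  ultimately show ?thesis by (metis UN_binaryset_eq sums_unique2)
qed

lemma signed_measures_Diff:
  assumes "\<mu> \<in> signed_measures M" "A \<in> sets M" "B \<in> sets M" "B \<subseteq> A"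
  shows "\<mu> A = \<mu> B + \<mu> (A - B)"
  using signed_measures_Un[OF assms(1,3), of "A - B"] assms by (simp add: Un_absorb1)

lemma signed_measures_Union:
  assumes "\<mu> \<in> signed_measures M" "finite C" "C \<subseteq> sets M" "disjoint C"
  shows "\<mu> (\<Union>C) = (\<Sum>A\<in>C. \<mu> A)"
  using assms(2-)
proof (induction C)
  case empty
  then show ?case by (simp add: signed_measures_empty[OF assms(1)])
next
  case (insert A C)
  then have "\<mu> (\<Union>C) = (\<Sum>A\<in>C. \<mu> A)" by (simp add: disjoint_def)
  moreover have "A \<inter> \<Union>C = {}" using insert by (auto simp: disjoint_def)
  moreover have "\<Union>C \<in> sets M" using insert by auto
  ultimately show ?case
    using insert signed_measures_Un[OF assms(1), of A "\<Union>C"] by simp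
qed

text \<open>If the range were unbounded, then any set with unbounded range splits into a part on which
  the range is again unbounded and a rest of measure at least 1 in absolute value; iterating gives
  disjoint sets whose measures do not tend to 0.\<close>

lemma signed_measures_bounded:
  assumes \<mu>: "\<mu> \<in> signed_measures M"
  shows "\<exists>B. \<forall>A. \<bar>\<mu> A\<bar> \<le> B"
proof (rule ccontr)
  assume unbounded: "\<not> ?thesis"
  define bad where "bad = (\<lambda>A. A \<in> sets M \<and> (\<forall>B. \<exists>C\<in>sets M. C \<subseteq> A \<and> B < \<bar>\<mu> C\<bar>))"
  have bad_sets: "A \<in> sets M" if "bad A" for A
    using that unfolding bad_def by (rule conjunct1)
  have badD: "\<exists>C\<in>sets M. C \<subseteq> A \<and> B < \<bar>\<mu> C\<bar>" if "bad A" for A B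
    using that unfolding bad_def by (elim conjE) (rule spec)
  have not_badD: "\<exists>B. \<forall>C\<in>sets M. C \<subseteq> A \<longrightarrow> \<bar>\<mu> C\<bar> \<le> B" if "A \<in> sets M" "\<not> bad A" for A
    using that unfolding bad_def not_less[symmetric] by simp
  have bad_space: "bad (space M)"
    unfolding bad_def
  proof (intro conjI allI)
    fix B
    \<comment> \<open>\<open>max B 0\<close> makes \<open>\<mu> A\<close> nonzero, which forces
      \<open>A\<close> to be measurable, as \<open>\<mu>\<close> vanishes on all other sets.\<close>
    obtain A where "max B 0 < \<bar>\<mu> A\<bar>" using unbounded by (meson not_le)
    moreover from this have "A \<in> sets M" using \<mu> by (auto simp: signed_measures_def)
    ultimately show "\<exists>C\<in>sets M. C \<subseteq> space M \<and> B < \<bar>\<mu> C\<bar>"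
      using sets.sets_into_space by auto
  qed auto
  have step: "\<exists>A'. bad A' \<and> A' \<subseteq> A \<and> 1 \<le> \<bar>\<mu> (A - A')\<bar>" if bad: "bad A" for A
  proof -
    \<comment> \<open>The margin \<open>1 + \<bar>\<mu> A\<bar>\<close> makes both \<open>C\<close>
      and \<open>A - C\<close> have measure at least 1 in absolute value, so either one may be the
      part that is removed.\<close>
    obtain C where C: "C \<in> sets M" "C \<subseteq> A" "1 + \<bar>\<mu> A\<bar> < \<bar>\<mu> C\<bar>"
      using badD[OF bad] by blast
    have A: "A \<in> sets M" using bad by (rule bad_sets)
    have "\<mu> A = \<mu> C + \<mu> (A - C)" using signed_measures_Diff[OF \<mu> A C(1,2)] .
    then have AC: "1 \<le> \<bar>\<mu> (A - C)\<bar>" using C(3) by linarith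
    consider "bad C" | "bad (A - C)"
    proof (atomize_elim, rule ccontr)
      assume "\<not> (bad C \<or> bad (A - C))"
      then have "\<not> bad C" "\<not> bad (A - C)" by auto
      moreover have AC: "A - C \<in> sets M" using A C(1) by (rule sets.Diff)
      ultimately obtain B1 B2 where B1: "\<forall>D\<in>sets M. D \<subseteq> C \<longrightarrow> \<bar>\<mu> D\<bar> \<le> B1"
          and B2: "\<forall>D\<in>sets M. D \<subseteq> A - C \<longrightarrow> \<bar>\<mu> D\<bar> \<le> B2"
        using not_badD[OF C(1)] not_badD[OF AC] by meson
      obtain D where D: "D \<in> sets M" "D \<subseteq> A" "B1 + B2 < \<bar>\<mu> D\<bar>"
        using badD[OF bad] by blast
      have "\<mu> D = \<mu> (D \<inter> C) + \<mu> (D - C)"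
        using signed_measures_Diff[OF \<mu> D(1), of "D \<inter> C"] D(1) C(1) by (simp add: Diff_Int)
      moreover have "\<bar>\<mu> (D \<inter> C)\<bar> \<le> B1" "\<bar>\<mu> (D - C)\<bar> \<le> B2"
        using B1[rule_format, of "D \<inter> C"] B2[rule_format, of "D - C"] C(1) D(1,2) by auto
      ultimately show False using D(3) by linarith
    qed
    then show ?thesis
    proof cases
      case 1
      with C(2) AC show ?thesis by blast
    next
      case 2
      moreover have "A - (A - C) = C" using C(2) by blast
      ultimately show ?thesis using C(3) by (intro exI[of _ "A - C"]) auto
    qed
  qed
  have "\<exists>f. \<forall>n. bad (f n) \<and> (f (Suc n) \<subseteq> f n \<and> 1 \<le> \<bar>\<mu> (f n - f (Suc n))\<bar>)"
    by (rule dependent_nat_choice[of "\<lambda>n. bad" "\<lambda>n A A'. A' \<subseteq> A \<and> 1 \<le> \<bar>\<mu> (A - A')\<bar>"])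
      (rule exI, rule bad_space, rule step)
  then obtain f where f: "\<forall>n. bad (f n) \<and> f (Suc n) \<subseteq> f n \<and> 1 \<le> \<bar>\<mu> (f n - f (Suc n))\<bar>"
    by (elim exE)
  then have f_Suc: "f (Suc n) \<subseteq> f n" "1 \<le> \<bar>\<mu> (f n - f (Suc n))\<bar>" for n
    by blast+
  have "decseq f" using f_Suc(1) by (rule decseq_SucI)
  have disj: "(f m - f (Suc m)) \<inter> (f n - f (Suc n)) = {}" if "m < n" for m n
    using decseqD[OF \<open>decseq f\<close>, of "Suc m" n] that by auto
  have "disjoint_family (\<lambda>n. f n - f (Suc n))"
    unfolding disjoint_family_on_def
  proof (intro ballI impI)
    fix m n :: nat
    assume "m \<noteq> n"
    then show "(f m - f (Suc m)) \<inter> (f n - f (Suc n)) = {}"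
      using disj[of m n] disj[of n m] by (cases m n rule: linorder_cases) (auto simp: Int_commute)
  qed
  moreover have "f n \<in> sets M" for n using f bad_sets by simp
  then have "range (\<lambda>n. f n - f (Suc n)) \<subseteq> sets M" by auto
  ultimately have "(\<lambda>n. \<mu> (f n - f (Suc n))) sums \<mu> (\<Union>n. f n - f (Suc n))"
    by (intro signed_measures_sums[OF \<mu>])
  then have "(\<lambda>n. \<mu> (f n - f (Suc n))) \<longlonglongrightarrow> 0"
    using sums_summable summable_LIMSEQ_zero by blast
  from LIMSEQ_D[OF this zero_less_one] obtain N
    where "\<And>n. n \<ge> N \<Longrightarrow> norm (\<mu> (f n - f (Suc n)) - 0) < 1" by auto
  then have "\<bar>\<mu> (f N - f (Suc N))\<bar> < 1" by force
  with f_Suc(2)[of N] show False by linarith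
qed

text \<open>A real supremum dominates its terms only if they are bounded. Grouping the cells of a
  partition by sign turns the sum into two values of \<open>\<mu>\<close>, so twice a bound of
  \<open>\<mu>\<close> suffices. The partition into \<open>A\<close> and its complement then gives
  the claim.\<close>

lemma abs_le_tv_norm:
  assumes \<mu>: "\<mu> \<in> signed_measures M" and A: "A \<in> sets M"
  shows "\<bar>\<mu> A\<bar> \<le> tv_norm M \<mu>"
proof -
  let ?\<C> = "{C. finite C \<and> C \<subseteq> sets M \<and> disjoint C \<and> \<Union>C = space M}"
  obtain B where B: "\<And>A. \<bar>\<mu> A\<bar> \<le> B" using signed_measures_bounded[OF \<mu>] by blast
  have "(\<Sum>A\<in>C. \<bar>\<mu> A\<bar>) \<le> 2 * B" if C: "C \<in> ?\<C>" for C
  proof -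
    let ?N = "{A \<in> C. \<mu> A < 0}" and ?P = "{A \<in> C. \<not> \<mu> A < 0}"
    have "(\<Sum>A\<in>C. \<bar>\<mu> A\<bar>) = (\<Sum>A\<in>?N \<union> ?P. \<bar>\<mu> A\<bar>)"
      by (intro sum.cong) auto
    also have "\<dots> = (\<Sum>A\<in>?N. \<bar>\<mu> A\<bar>) + (\<Sum>A\<in>?P. \<bar>\<mu> A\<bar>)"
      using C by (intro sum.union_disjoint) auto
    also have "\<dots> = - (\<Sum>A\<in>?N. \<mu> A) + (\<Sum>A\<in>?P. \<mu> A)"
      by (simp add: sum_negf[symmetric])
    also have "\<dots> = - \<mu> (\<Union>?N) + \<mu> (\<Union>?P)"
      using C by (subst (1 2) signed_measures_Union[OF \<mu>]) (auto simp: disjoint_def)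
    also have "\<dots> \<le> 2 * B" using B[of "\<Union>?N"] B[of "\<Union>?P"] by linarith
    finally show ?thesis .
  qed
  then have bdd: "bdd_above ((\<lambda>C. \<Sum>A\<in>C. \<bar>\<mu> A\<bar>) ` ?\<C>)"
    by (intro bdd_aboveI2)
  have C: "{A, space M - A} \<in> ?\<C>"
    using A sets.sets_into_space by (auto simp: disjoint_def)
  have "\<bar>\<mu> A\<bar> \<le> (\<Sum>A\<in>{A, space M - A}. \<bar>\<mu> A\<bar>)"
    by (rule member_le_sum) auto
  also have "\<dots> \<le> tv_norm M \<mu>"
    unfolding tv_norm_def by (rule cSUP_upper[OF C bdd])
  finally show ?thesis .
qed

section \<open>Mixtures and the vector space structure of \<open>E_space\<close>\<close>

lemma sets_mixture [simp]: "sets (mixture t p q) = sets p"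
  by (simp add: mixture_def)

lemma measure_mixture:
  assumes p: "p \<in> space (prob_algebra M)" and q: "q \<in> space (prob_algebra M)" and t: "t \<in> {0..1}"
  shows "measure (mixture t p q) A = t * measure p A + (1 - t) * measure q A"
proof -
  interpret p: prob_space p using p by (simp add: space_prob_algebra)
  interpret q: prob_space q using q by (simp add: space_prob_algebra)
  have sets_eq: "sets q = sets p" using p q by (simp add: space_prob_algebra)
  show ?thesis
  proof (cases "A \<in> sets p")
    case True
    have "countably_additive (sets (mixture t p q))
        (\<lambda>A. ennreal t * emeasure p A + ennreal (1 - t) * emeasure q A)"
      by (intro countably_additiveI)
        (auto simp: mixture_def sets_eq suminf_add[symmetric] suminf_emeasure)
    then have "emeasure (mixture t p q) A = ennreal t * emeasure p A + ennreal (1 - t) * emeasure q A"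
      using True sets.space_closed[of p]
      by (intro emeasure_measure_of[OF mixture_def]) (auto simp: positive_def)
    then have "emeasure (mixture t p q) A = ennreal (t * measure p A + (1 - t) * measure q A)"
      using t by (simp add: p.emeasure_eq_measure q.emeasure_eq_measure ennreal_mult' ennreal_plus)
    then show ?thesis using t by (intro measure_eq_emeasure_eq_ennreal) auto
  next
    case False
    then show ?thesis by (simp add: measure_notin_sets sets_eq mixture_def)
  qed
qed

lemma signed_ac_prob_iff:
  assumes "p \<in> space (prob_algebra M)"
  shows "signed_ac p \<mu> \<longleftrightarrow> (\<forall>A\<in>sets M. measure p A = 0 \<longrightarrow> \<mu> A = 0)"
proof -
  interpret prob_space p using assms by (simp add: space_prob_algebra)
  show ?thesis
    using assms by (auto simp: signed_ac_def null_sets_def emeasure_eq_measure space_prob_algebra)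
qed

lemma E_space_scale:
  assumes "\<mu> \<in> E_space M P"
  shows "(\<lambda>A. c * \<mu> A) \<in> E_space M P"
  using assms by (auto simp: E_space_def signed_measures_def signed_ac_def intro!: sums_mult)

text \<open>The midpoint of \<open>p\<close> and \<open>q\<close> has only the common null sets of
  both, so it dominates the sum; this is how convexity of \<open>P\<close> makes
  \<open>E_space\<close> a vector space.\<close>

lemma E_space_add:
  assumes P: "P \<subseteq> space (prob_algebra M)" "convex_measures P"
    and \<mu>: "\<mu> \<in> E_space M P" and \<nu>: "\<nu> \<in> E_space M P"
  shows "(\<lambda>A. \<mu> A + \<nu> A) \<in> E_space M P"
proof -
  obtain p q where p: "p \<in> P" "signed_ac p \<mu>" and q: "q \<in> P" "signed_ac q \<nu>"
    using \<mu> \<nu> by (auto simp: E_space_def)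
  have r: "mixture (1/2) p q \<in> P"
    using P(2) p(1) q(1) by (auto simp: convex_measures_def)
  have prob: "p \<in> space (prob_algebra M)" "q \<in> space (prob_algebra M)"
      "mixture (1/2) p q \<in> space (prob_algebra M)"
    using p q r P(1) by auto
  have "measure (mixture (1/2) p q) A = 0 \<longleftrightarrow> measure p A = 0 \<and> measure q A = 0" for A
    using measure_mixture[of p M q "1/2" A] prob by (simp add: add_nonneg_eq_0_iff)
  then have "signed_ac (mixture (1/2) p q) (\<lambda>A. \<mu> A + \<nu> A)"
    using p q prob by (simp add: signed_ac_prob_iff)
  moreover have "(\<lambda>A. \<mu> A + \<nu> A) \<in> signed_measures M"
    using \<mu> \<nu> by (auto simp: E_space_def signed_measures_def intro!: sums_add)
  ultimately show ?thesis using r by (auto simp: E_space_def)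
qed

section \<open>Measures as elements of \<open>E_space\<close> and their integrals\<close>

lemma measure_in_signed_measures:
  assumes "finite_measure N" "sets N = sets M"
  shows "measure N \<in> signed_measures M"
  using assms finite_measure.finite_measure_UNION[of N]
  by (auto simp: signed_measures_def measure_notin_sets)

text \<open>By monotonicity the supremum defining the positive part on \<open>A\<close> is attained
  at \<open>A\<close> itself, while the negative part has total mass 0.\<close>

lemma signed_integral_measure:
  assumes "finite_measure N" "sets N = sets M"
  shows "signed_integral M (measure N) h = integral\<^sup>L N h"
proof -
  interpret finite_measure N by fact
  have "pos_part M (measure N) = measure_of (space M) (sets M) (emeasure N)"
    unfolding pos_part_def
  proof (rule measure_of_eq)
    fix A assume "A \<in> sigma_sets (space M) (sets M)"
    then have A: "A \<in> sets M" by (simp add: sets.sigma_sets_eq)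
    show "(SUP B\<in>{B \<in> sets M. B \<subseteq> A}. ennreal (measure N B)) = emeasure N A"
      using A assms(2)
      by (intro antisym SUP_least) (auto simp: emeasure_eq_measure[symmetric] intro!: emeasure_mono SUP_upper)
  qed (rule sets.space_closed)
  also have "\<dots> = N"
    using assms(2) sets_eq_imp_space_eq[OF assms(2)] measure_of_of_measure[of N] by simp
  finally have pos: "pos_part M (measure N) = N" .
  have "(SUP B\<in>{B \<in> sets M. B \<subseteq> space M}. ennreal (- measure N B)) = (0::ennreal)"
    by (intro antisym SUP_least) (auto simp: ennreal_neg)
  then have "space M \<in> null_sets (pos_part M (\<lambda>A. - measure N A))"
    by (auto simp: null_sets_def pos_part_def emeasure_measure_of_conv split: if_splits)
  then have "integral\<^sup>L (pos_part M (\<lambda>A. - measure N A)) h = 0"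
    by (intro integral_eq_zero_AE AE_I') auto
  with pos show ?thesis by (simp add: signed_integral_def)
qed

text \<open>Lets the lemmas about a dominated family \<open>Q\<close> be applied to \<open>P\<close>
  itself.\<close>

lemma dominated_by_refl: "dominated_by P P"
  by (auto simp: dominated_by_def absolutely_continuous_def)

lemma dominated_measure_in_E_space:
  assumes "dominated_by Q P" "q \<in> Q" "absolutely_continuous q N" "finite_measure N" "sets N = sets M"
  shows "measure N \<in> E_space M P"
proof -
  obtain p where "p \<in> P" "absolutely_continuous p q"
    using assms(1,2) by (auto simp: dominated_by_def)
  then have "signed_ac p (measure N)"
    using assms(3) by (auto simp: signed_ac_def absolutely_continuous_def measure_eq_0_null_sets)
  then show ?thesis
    using \<open>p \<in> P\<close> measure_in_signed_measures[OF assms(4,5)] by (auto simp: E_space_def)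
qed

text \<open>The quasi-sure bound fails only on a set that is null for the \<open>p\<close>
  dominating \<open>q\<close>, hence for \<open>q\<close>.\<close>

lemma Linf_fun_integrable:
  assumes P: "P \<subseteq> space (prob_algebra M)" and Q: "Q \<subseteq> space (prob_algebra M)"
    and dom: "dominated_by Q P" and q: "q \<in> Q" and X: "X \<in> Linf_fun M P"
  shows "integrable q X" and "A \<in> sets M \<Longrightarrow> integrable q (\<lambda>x. indicator A x * X x)"
proof -
  interpret q: prob_space q using q Q by (auto simp: space_prob_algebra)
  have q_M: "sets q = sets M" "space q = space M"
    using q Q sets_eq_imp_space_eq[of q M] by (auto simp: space_prob_algebra)
  obtain C N where N: "N \<in> sets M" "{x \<in> space M. \<not> \<bar>X x\<bar> \<le> C} \<subseteq> N"
      "\<And>p. p \<in> P \<Longrightarrow> emeasure p N = 0"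
    using X by (auto simp: Linf_fun_def holds_qs_def polar_def)
  obtain p where p: "p \<in> P" "absolutely_continuous p q"
    using dom q by (auto simp: dominated_by_def)
  have "N \<in> null_sets p" using N p P by (auto simp: null_sets_def space_prob_algebra)
  then have "N \<in> null_sets q" using p by (auto simp: absolutely_continuous_def)
  then have "AE x in q. norm (X x) \<le> C"
    using N(2) q_M by (intro AE_I') auto
  moreover have "X \<in> borel_measurable q"
    using X q_M by (auto simp: Linf_fun_def cong: measurable_cong_sets)
  ultimately show X_int: "integrable q X" by (rule q.integrable_const_bound)
  show "integrable q (\<lambda>x. indicator A x * X x)" if "A \<in> sets M"
    using integrable_mult_indicator[OF _ X_int, of A] that q_M by simp
qed

section \<open>A compact convex set of functionals on \<open>E_space\<close>\<close>

text \<open>Under \<open>l\<close>, these are the functionals given by the \<open>h\<close> with \<open>0 \<le> h \<le> 1\<close> quasi-surely.\<close>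

definition unit_functionals :: "'a measure \<Rightarrow> 'a measure set \<Rightarrow> (('a set \<Rightarrow> real) \<Rightarrow> real) set" where
  "unit_functionals M P = {\<phi> \<in> extensional (E_space M P).
     (\<forall>\<mu>\<in>E_space M P. \<forall>\<nu>\<in>E_space M P. \<phi> (\<lambda>A. \<mu> A + \<nu> A) = \<phi> \<mu> + \<phi> \<nu>) \<and>
     (\<forall>c. \<forall>\<mu>\<in>E_space M P. \<phi> (\<lambda>A. c * \<mu> A) = c * \<phi> \<mu>) \<and>
     (\<forall>\<mu>\<in>E_space M P. \<bar>\<phi> \<mu>\<bar> \<le> tv_norm M \<mu>) \<and>
     (\<forall>\<mu>\<in>E_space M P. (\<forall>A. 0 \<le> \<mu> A) \<longrightarrow> 0 \<le> \<phi> \<mu> \<and> \<phi> \<mu> \<le> \<mu> (space M))}"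

text \<open>By linearity, the bound by \<open>tv_norm\<close> makes \<open>\<phi>\<close> Lipschitz
  with constant 1.\<close>

lemma unit_functionals_subset_E_dual:
  assumes P: "P \<subseteq> space (prob_algebra M)" "convex_measures P"
  shows "unit_functionals M P \<subseteq> E_dual M P"
proof
  fix \<phi> assume \<phi>: "\<phi> \<in> unit_functionals M P"
  have "\<bar>\<phi> \<nu> - \<phi> \<mu>\<bar> \<le> tv_norm M (\<lambda>A. \<nu> A - \<mu> A)"
    if "\<mu> \<in> E_space M P" "\<nu> \<in> E_space M P" for \<mu> \<nu>
  proof -
    have neg: "(\<lambda>A. - \<mu> A) \<in> E_space M P" "\<phi> (\<lambda>A. - \<mu> A) = - \<phi> \<mu>"
      using E_space_scale[OF that(1), of "-1"] \<phi> that(1)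
      by (auto simp: unit_functionals_def dest!: bspec spec[of _ "-1"])
    then have "(\<lambda>A. \<nu> A - \<mu> A) \<in> E_space M P" "\<phi> (\<lambda>A. \<nu> A - \<mu> A) = \<phi> \<nu> - \<phi> \<mu>"
      using E_space_add[OF P that(2) neg(1)] \<phi> that(2) by (auto simp: unit_functionals_def)
    then show ?thesis using \<phi> by (auto simp: unit_functionals_def)
  qed
  then have "\<exists>d>0. \<forall>\<nu>\<in>E_space M P. tv_norm M (\<lambda>A. \<nu> A - \<mu> A) < d \<longrightarrow> \<bar>\<phi> \<nu> - \<phi> \<mu>\<bar> < e"
    if "\<mu> \<in> E_space M P" "e > 0" for \<mu> e
    using that by (meson order.strict_trans1)
  with \<phi> show "\<phi> \<in> E_dual M P" by (auto simp: E_dual_def unit_functionals_def)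
qed

text \<open>The Banach-Alaoglu argument: pointwise convergence on \<open>E\<close> is the product topology, and
  \<open>\<bar>\<phi> \<mu>\<bar> \<le> \<parallel>\<mu>\<parallel>\<close> confines \<open>\<phi>\<close> to a product of compact intervals.\<close>

lemma compact_unit_functionals: "compact (unit_functionals M P)"
proof -
  let ?E = "E_space M P"
  \<comment> \<open>Extensional functions take the value \<open>undefined\<close> off
    \<open>E_space\<close>, so a singleton is the right compact factor there.\<close>
  define I where "I = (\<lambda>\<mu>. if \<mu> \<in> ?E then {- tv_norm M \<mu>..tv_norm M \<mu>} else {undefined})"
  have "compactin (product_topology (\<lambda>\<mu>. euclidean) UNIV) (PiE UNIV I)"
    by (subst compactin_PiE) (auto simp: I_def)
  then have "compact (PiE UNIV I)" by (simp add: euclidean_product_topology)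
  moreover have "closed {\<phi> :: ('a set \<Rightarrow> real) \<Rightarrow> real.
     (\<forall>\<mu>\<in>?E. \<forall>\<nu>\<in>?E. \<phi> (\<lambda>A. \<mu> A + \<nu> A) = \<phi> \<mu> + \<phi> \<nu>) \<and>
     (\<forall>c. \<forall>\<mu>\<in>?E. \<phi> (\<lambda>A. c * \<mu> A) = c * \<phi> \<mu>) \<and>
     (\<forall>\<mu>\<in>?E. (\<forall>A. 0 \<le> \<mu> A) \<longrightarrow> 0 \<le> \<phi> \<mu> \<and> \<phi> \<mu> \<le> \<mu> (space M))}"
    \<comment> \<open>Each single condition compares finitely many coordinates of
      \<open>\<phi>\<close>, and the premises of the implications do not depend on
      \<open>\<phi>\<close>.\<close>
    unfolding Ball_def
    by (intro closed_Collect_conj closed_Collect_all closed_Collect_imp closed_Collect_eq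
        closed_Collect_le open_Collect_const continuous_intros continuous_on_product_coordinates)
  ultimately have "compact (PiE UNIV I \<inter> {\<phi>.
     (\<forall>\<mu>\<in>?E. \<forall>\<nu>\<in>?E. \<phi> (\<lambda>A. \<mu> A + \<nu> A) = \<phi> \<mu> + \<phi> \<nu>) \<and>
     (\<forall>c. \<forall>\<mu>\<in>?E. \<phi> (\<lambda>A. c * \<mu> A) = c * \<phi> \<mu>) \<and>
     (\<forall>\<mu>\<in>?E. (\<forall>A. 0 \<le> \<mu> A) \<longrightarrow> 0 \<le> \<phi> \<mu> \<and> \<phi> \<mu> \<le> \<mu> (space M))})"
    by (rule compact_Int_closed)
  moreover have "\<phi> \<in> PiE UNIV I \<longleftrightarrow> \<phi> \<in> extensional ?E \<and> (\<forall>\<mu>\<in>?E. \<bar>\<phi> \<mu>\<bar> \<le> tv_norm M \<mu>)" for \<phi>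
    by (auto simp: PiE_def Pi_def I_def extensional_def abs_le_iff split: if_splits)
  then have "PiE UNIV I \<inter> {\<phi>.
     (\<forall>\<mu>\<in>?E. \<forall>\<nu>\<in>?E. \<phi> (\<lambda>A. \<mu> A + \<nu> A) = \<phi> \<mu> + \<phi> \<nu>) \<and>
     (\<forall>c. \<forall>\<mu>\<in>?E. \<phi> (\<lambda>A. c * \<mu> A) = c * \<phi> \<mu>) \<and>
     (\<forall>\<mu>\<in>?E. (\<forall>A. 0 \<le> \<mu> A) \<longrightarrow> 0 \<le> \<phi> \<mu> \<and> \<phi> \<mu> \<le> \<mu> (space M))} = unit_functionals M P"
    unfolding unit_functionals_def by blast
  ultimately show ?thesis by simp
qed

lemma convex_unit_functionals:
  assumes \<phi>: "\<phi> \<in> unit_functionals M P" and \<psi>: "\<psi> \<in> unit_functionals M P" and t: "t \<in> {0..1}"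
  shows "(\<lambda>\<mu>. t * \<phi> \<mu> + (1 - t) * \<psi> \<mu>) \<in> unit_functionals M P"
proof -
  have "\<bar>t * \<phi> \<mu> + (1 - t) * \<psi> \<mu>\<bar> \<le> tv_norm M \<mu>" if "\<mu> \<in> E_space M P" for \<mu>
    using convex_bound_le[of "\<phi> \<mu>" "tv_norm M \<mu>" "\<psi> \<mu>" t "1 - t"]
      convex_bound_le[of "- \<phi> \<mu>" "tv_norm M \<mu>" "- \<psi> \<mu>" t "1 - t"] \<phi> \<psi> that t
    by (auto simp: unit_functionals_def abs_le_iff)
  moreover have "t * \<phi> \<mu> + (1 - t) * \<psi> \<mu> \<le> \<mu> (space M)"
    if "\<mu> \<in> E_space M P" "\<forall>A. 0 \<le> \<mu> A" for \<mu>
    using that \<phi> \<psi> t by (intro convex_bound_le) (auto simp: unit_functionals_def)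
  moreover have "0 \<le> t * \<phi> \<mu> + (1 - t) * \<psi> \<mu>"
    if "\<mu> \<in> E_space M P" "\<forall>A. 0 \<le> \<mu> A" for \<mu>
    using that \<phi> \<psi> t by (intro add_nonneg_nonneg mult_nonneg_nonneg) (auto simp: unit_functionals_def)
  \<comment> \<open>Besides the norm bound and positivity, extensionality has to survive: with
    \<open>u = undefined\<close> this gives the value off \<open>E_space\<close>.\<close>
  moreover have "t * u + (1 - t) * u = u" for u :: real by (simp add: left_diff_distrib)
  ultimately show ?thesis
    using \<phi> \<psi> by (simp add: unit_functionals_def extensional_def distrib_left ac_simps)
qed

text \<open>This is the functional of the indicator of \<open>A\<close>, at which the minimax
  inequality will be tested.\<close>

lemma evaluation_in_unit_functionals:
  assumes P: "P \<subseteq> space (prob_algebra M)" "convex_measures P" and A: "A \<in> sets M"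
  shows "(\<lambda>\<mu>\<in>E_space M P. \<mu> A) \<in> unit_functionals M P"
proof -
  have "\<mu> A \<le> \<mu> (space M)" if "\<mu> \<in> E_space M P" "\<forall>A. 0 \<le> \<mu> A" for \<mu>
    using signed_measures_Diff[of \<mu> M "space M" A] that A sets.sets_into_space[OF A]
    by (simp add: E_space_def)
  moreover have "\<bar>\<mu> A\<bar> \<le> tv_norm M \<mu>" if "\<mu> \<in> E_space M P" for \<mu>
    using that A abs_le_tv_norm by (auto simp: E_space_def)
  ultimately show ?thesis
    using E_space_add[OF P] E_space_scale[of _ M P] by (auto simp: unit_functionals_def)
qed

section \<open>Integral bounds for a function representing a functional\<close>

text \<open>Evaluate the functional at the restriction of \<open>q\<close> to \<open>A\<close>, a
  positive element of \<open>E_space\<close> with mass \<open>measure q A\<close>. These integrated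
  bounds replace the quasi-sure inequality \<open>0 \<le> h \<le> 1\<close>.\<close>

lemma unit_functional_integral:
  assumes Q: "Q \<subseteq> space (prob_algebra M)" and dom: "dominated_by Q P" and q: "q \<in> Q"
    and h: "h \<in> Linf_fun M P" and l: "l_fun M P h \<in> unit_functionals M P" and A: "A \<in> sets M"
  shows "0 \<le> (\<integral>x. indicator A x * h x \<partial>q)"
    and "(\<integral>x. indicator A x * h x \<partial>q) \<le> measure q A"
proof -
  let ?N = "density q (indicator A)"
  have q_M: "sets q = sets M" "space q = space M"
    using q Q sets_eq_imp_space_eq[of q M] by (auto simp: space_prob_algebra)
  interpret q: prob_space q using q Q by (auto simp: space_prob_algebra)
  have N: "finite_measure ?N" using A q_M by (intro q.finite_measure_restricted) auto
  have "absolutely_continuous q ?N"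
    using A q_M by (intro absolutely_continuousI_density) auto
  then have E: "measure ?N \<in> E_space M P"
    using dominated_measure_in_E_space[OF dom q _ N] q_M by simp
  have "h \<in> borel_measurable q"
    using h q_M by (auto simp: Linf_fun_def cong: measurable_cong_sets)
  then have "integral\<^sup>L ?N h = (\<integral>x. indicator A x * h x \<partial>q)"
    using integral_density[of h q "indicator A"] A q_M by (simp add: ennreal_indicator)
  then have "l_fun M P h (measure ?N) = (\<integral>x. indicator A x * h x \<partial>q)"
    using E q_M by (simp add: l_fun_def signed_integral_measure[OF N])
  moreover have "measure ?N (space M) = measure q A"
    using A q_M sets.sets_into_space[OF A] by (simp add: measure_def emeasure_restricted Int_absorb2)
  moreover have "0 \<le> l_fun M P h (measure ?N) \<and> l_fun M P h (measure ?N) \<le> measure ?N (space M)"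
    using l E by (simp add: unit_functionals_def)
  ultimately show "0 \<le> (\<integral>x. indicator A x * h x \<partial>q)"
    and "(\<integral>x. indicator A x * h x \<partial>q) \<le> measure q A" by simp_all
qed

lemma l_fun_measure_split:
  assumes P: "P \<subseteq> space (prob_algebra M)" and Q: "Q \<subseteq> space (prob_algebra M)"
    and dom: "dominated_by Q P" and q: "q \<in> Q" and h: "h \<in> Linf_fun M P" and A: "A \<in> sets M"
  shows "l_fun M P h (measure q) =
    (\<integral>x. indicator A x * h x \<partial>q) + (\<integral>x. indicator (space M - A) x * h x \<partial>q)"
proof -
  have q_M: "sets q = sets M" "space q = space M"
    using q Q sets_eq_imp_space_eq[of q M] by (auto simp: space_prob_algebra)
  interpret q: prob_space q using q Q by (auto simp: space_prob_algebra)
  have "measure q \<in> E_space M P"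
    using dominated_measure_in_E_space[OF dom q _ q.finite_measure_axioms q_M(1)]
    by (simp add: absolutely_continuous_def)
  then have "l_fun M P h (measure q) = integral\<^sup>L q h"
    using q_M by (simp add: l_fun_def signed_integral_measure[OF q.finite_measure_axioms])
  also have "\<dots> = (\<integral>x. indicator A x * h x + indicator (space M - A) x * h x \<partial>q)"
    using q_M by (intro Bochner_Integration.integral_cong) (auto simp: indicator_def)
  also have "\<dots> = (\<integral>x. indicator A x * h x \<partial>q) + (\<integral>x. indicator (space M - A) x * h x \<partial>q)"
    using A by (intro Bochner_Integration.integral_add Linf_fun_integrable(2)[OF P Q dom q h]) auto
  finally show ?thesis .
qed

section \<open>From the compact convex set \<open>K\<close> to a single \<open>q\<close>\<close>

theorem theorem2p3:
  fixes M :: "'a measure" and P Q :: "'a measure set" and \<epsilon> \<delta> :: real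
  assumes "P \<subseteq> space (prob_algebra M)" and "P \<noteq> {}" and "convex_measures P"
    and "Q \<subseteq> space (prob_algebra M)" and "Q \<noteq> {}" and "convex_measures Q"
    and "dominated_by Q P"
    and "l_map M P ` Linf M P = E_dual M P"
    and "\<epsilon> > 0" and "\<delta> > 0"
    and "\<forall>A\<in>sets M. (\<exists>p\<in>P. measure p A \<ge> \<epsilon>) \<longrightarrow> (\<exists>q\<in>Q. measure q A \<ge> \<delta>)"
  shows "\<forall>p\<in>P. \<exists>q\<in>Q. \<forall>A\<in>sets M. measure p A \<ge> 2 * \<epsilon> \<longrightarrow> measure q A \<ge> \<epsilon> * \<delta> / 2"
proof
  fix p assume p: "p \<in> P"
  note P = \<open>P \<subseteq> space (prob_algebra M)\<close> \<open>convex_measures P\<close>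
  \<comment> \<open>The factor 1/2 leaves the gap below \<open>\<epsilon> * \<delta>\<close> that
    lets closed conditions \<open>\<phi> (measure q) \<le> a\<close> exclude all of
    \<open>K\<close>.\<close>
  define a where "a = \<epsilon> * \<delta> / 2"
  have a: "a < \<epsilon> * \<delta>" using \<open>\<epsilon> > 0\<close> \<open>\<delta> > 0\<close> by (simp add: a_def)
  have E: "measure p \<in> E_space M P"
    using dominated_measure_in_E_space[OF dominated_by_refl p] p P(1)
    by (auto simp: space_prob_algebra absolutely_continuous_def prob_space_def)
  have QE: "measure q \<in> E_space M P" if "q \<in> Q" for q
    using dominated_measure_in_E_space[OF assms(7) that] that assms(4)
    by (auto simp: space_prob_algebra absolutely_continuous_def prob_space_def)
  define K where "K = unit_functionals M P \<inter> {\<phi>. 2 * \<epsilon> \<le> \<phi> (measure p)}"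
  have large: "\<exists>q\<in>Q. \<epsilon> * \<delta> \<le> \<phi> (measure q)" if "\<phi> \<in> K" for \<phi>
  proof -
    have \<phi>: "\<phi> \<in> unit_functionals M P" "2 * \<epsilon> \<le> \<phi> (measure p)" using that by (auto simp: K_def)
    \<comment> \<open>Surjectivity of \<open>l\<close> enters here: it turns a functional from the
      compact set into a function \<open>h\<close>, whose level set can be fed to the hypothesis on
      \<open>P\<close> and \<open>Q\<close>.\<close>
    then have "\<phi> \<in> l_map M P ` Linf M P"
      using unit_functionals_subset_E_dual[OF P] assms(8) by auto
    then obtain h where h: "h \<in> Linf_fun M P" and \<phi>_h: "\<phi> = l_fun M P h"
      using l_map_class[OF P(1)] by (auto simp: Linf_def quotient_def)
    have [measurable]: "h \<in> borel_measurable M" using h by (simp add: Linf_fun_def)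
    define A where "A = {x \<in> space M. \<epsilon> \<le> h x}"
    have A: "A \<in> sets M" unfolding A_def by measurable
    have A': "space M - A \<in> sets M" using A by auto
    note restr = unit_functional_integral[OF _ _ _ h \<phi>(1)[unfolded \<phi>_h]]
    have meas_p: "prob_space p" "sets p = sets M" "space p = space M"
      using p P(1) sets_eq_imp_space_eq[of p M] by (auto simp: space_prob_algebra)
    \<comment> \<open>A Markov-type estimate: off \<open>A\<close> the integral is at most
      \<open>\<epsilon>\<close>, on \<open>A\<close> at most \<open>measure p A\<close>. As the
      total is at least \<open>2 * \<epsilon>\<close>, \<open>A\<close> has mass at least
      \<open>\<epsilon>\<close> under \<open>p\<close>.\<close>
    have "(\<integral>x. indicator (space M - A) x * h x \<partial>p) \<le> (\<integral>x. \<epsilon> \<partial>p)"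
      using A' meas_p \<open>\<epsilon> > 0\<close> Linf_fun_integrable(2)[OF P(1) P(1) dominated_by_refl p h A']
      by (intro integral_mono)
        (auto simp: A_def indicator_def prob_space_def finite_measure.integrable_const)
    also have "\<dots> = \<epsilon>" using meas_p prob_space.prob_space[of p] by simp
    finally have "2 * \<epsilon> \<le> measure p A + \<epsilon>"
      using \<phi>(2) l_fun_measure_split[OF P(1) P(1) dominated_by_refl p h A]
        restr(2)[OF P(1) dominated_by_refl p A] by (simp add: \<phi>_h)
    then obtain q where q: "q \<in> Q" "\<delta> \<le> measure q A"
      using assms(11) A p by force
    have meas_q: "prob_space q" "sets q = sets M" "space q = space M"
      using q assms(4) sets_eq_imp_space_eq[of q M] by (auto simp: space_prob_algebra)
    interpret q: prob_space q by (rule meas_q(1))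
    have "integrable q (\<lambda>x. indicator A x * \<epsilon>)"
      using integrable_mult_indicator[of A q "\<lambda>_. \<epsilon>"] A meas_q(2) by simp
    note int_q = this Linf_fun_integrable(2)[OF P(1) assms(4,7) q(1) h A]
    have "\<epsilon> * \<delta> \<le> \<epsilon> * measure q A" using q(2) \<open>\<epsilon> > 0\<close> by simp
    also have "\<dots> = (\<integral>x. indicator A x * \<epsilon> \<partial>q)"
      using A meas_q sets.sets_into_space[OF A] by (simp add: Int_absorb2)
    also have "\<dots> \<le> (\<integral>x. indicator A x * h x \<partial>q)"
      by (rule integral_mono[OF int_q]) (auto simp: A_def indicator_def)
    \<comment> \<open>The integral over the complement of \<open>A\<close> is nonnegative and may be
      added.\<close>
    also have "\<dots> \<le> \<phi> (measure q)"
      using l_fun_measure_split[OF P(1) assms(4,7) q(1) h A]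
        restr(1)[OF assms(4,7) q(1) A'] by (simp add: \<phi>_h)
    finally show ?thesis using q(1) by blast
  qed
  have K: "compact K"
    unfolding K_def
    by (intro compact_Int_closed compact_unit_functionals closed_Collect_le continuous_intros
        continuous_on_product_coordinates)
  have closed_le: "closed {\<phi> :: ('a set \<Rightarrow> real) \<Rightarrow> real. \<phi> (measure q) \<le> a}" for q
    by (intro closed_Collect_le continuous_intros continuous_on_product_coordinates)
  have K_empty: "K \<inter> (\<Inter>q\<in>Q. {\<phi>. \<phi> (measure q) \<le> a}) = {}"
  proof (rule equals0I)
    fix \<phi> assume \<phi>: "\<phi> \<in> K \<inter> (\<Inter>q\<in>Q. {\<phi>. \<phi> (measure q) \<le> a})"
    then obtain q where "q \<in> Q" "\<epsilon> * \<delta> \<le> \<phi> (measure q)" using large[of \<phi>] by blast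
    moreover from this \<phi> have "\<phi> (measure q) \<le> a" by simp
    ultimately show False using a by linarith
  qed
  \<comment> \<open>The finite intersection property of the compact set \<open>K\<close> reduces
    \<open>Q\<close> to finitely many measures.\<close>
  have "\<exists>F. finite F \<and> F \<subseteq> Q \<and> K \<inter> (\<Inter>q\<in>F. {\<phi>. \<phi> (measure q) \<le> a}) = {}"
  proof (rule ccontr)
    assume *: "\<nexists>F. finite F \<and> F \<subseteq> Q \<and> K \<inter> (\<Inter>q\<in>F. {\<phi>. \<phi> (measure q) \<le> a}) = {}"
    have "K \<inter> (\<Inter>q\<in>Q. {\<phi>. \<phi> (measure q) \<le> a}) \<noteq> {}"
      by (rule compact_imp_fip_image[OF K closed_le]) (use * in simp)
    with K_empty show False by contradiction
  qed
  then obtain F where F: "finite F" "F \<subseteq> Q" "K \<inter> (\<Inter>q\<in>F. {\<phi>. \<phi> (measure q) \<le> a}) = {}"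
    by (elim exE conjE)
  \<comment> \<open>\<open>F\<close> is empty if \<open>K\<close> is, whereas the minimax lemma
    wants a nonempty finite family; hence the extra \<open>q0\<close>.\<close>
  obtain q0 where "q0 \<in> Q" using \<open>Q \<noteq> {}\<close> by blast
  have "\<exists>s\<in>measure ` Q. \<forall>\<phi>\<in>K. a \<le> \<phi> s"
  proof (rule finite_minimax)
    show "finite (measure ` insert q0 F)" "measure ` insert q0 F \<noteq> {}"
      "measure ` insert q0 F \<subseteq> measure ` Q"
      using F \<open>q0 \<in> Q\<close> by auto
    show "(\<lambda>s. t * \<phi> s + (1 - t) * \<psi> s) \<in> K" if "\<phi> \<in> K" "\<psi> \<in> K" "t \<in> {0..1}" for \<phi> \<psi> t
    proof -
      \<comment> \<open>The signs are reversed because \<open>convex_bound_le\<close> yields upper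
        bounds.\<close>
      have "- (t * \<phi> (measure p) + (1 - t) * \<psi> (measure p)) \<le> - (2 * \<epsilon>)"
        using convex_bound_le[of "- \<phi> (measure p)" "- (2 * \<epsilon>)" "- \<psi> (measure p)" t "1 - t"] that
        by (simp add: K_def)
      then show ?thesis
        using convex_unit_functionals[of \<phi> M P \<psi> t] that by (simp add: K_def)
    qed
    show "\<exists>r\<in>measure ` Q. \<forall>\<phi>\<in>K. \<phi> r = t * \<phi> s + (1 - t) * \<phi> s'"
      if ss': "s \<in> measure ` Q" "s' \<in> measure ` Q" and t: "t \<in> {0..1}" for s s' t
    proof -
      obtain q q' where q: "q \<in> Q" "q' \<in> Q" "s = measure q" "s' = measure q'" using ss' by blast
      have "mixture t q q' \<in> Q"
        using \<open>convex_measures Q\<close> q t by (auto simp: convex_measures_def)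
      moreover have "\<phi> (measure (mixture t q q')) = t * \<phi> s + (1 - t) * \<phi> s'" if "\<phi> \<in> K" for \<phi>
      proof -
        \<comment> \<open>Written as a sum of two scaled elements of \<open>E_space\<close>, the
          mixture is open to the linearity of \<open>\<phi>\<close>.\<close>
        have "measure (mixture t q q') = (\<lambda>A. t * s A + (1 - t) * s' A)"
          using measure_mixture[of q M q' t] q t assms(4) by (auto simp: fun_eq_iff)
        moreover have "(\<lambda>A. t * s A) \<in> E_space M P" "(\<lambda>A. (1 - t) * s' A) \<in> E_space M P"
          unfolding q(3,4) using q(1,2) by (auto intro!: E_space_scale QE)
        ultimately show ?thesis
          using that QE q by (simp add: K_def unit_functionals_def)
      qed
      ultimately show ?thesis by blast
    qed
    show "\<exists>s\<in>measure ` insert q0 F. a \<le> \<phi> s" if "\<phi> \<in> K" for \<phi>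
    proof -
      have "\<phi> \<notin> (\<Inter>q\<in>F. {\<phi>. \<phi> (measure q) \<le> a})" using F(3) that by blast
      then obtain q where "q \<in> F" "a \<le> \<phi> (measure q)" by auto
      then show ?thesis by blast
    qed
  qed
  then obtain q where q: "q \<in> Q" "\<And>\<phi>. \<phi> \<in> K \<Longrightarrow> a \<le> \<phi> (measure q)" by blast
  have "a \<le> measure q A" if A: "A \<in> sets M" "2 * \<epsilon> \<le> measure p A" for A
    using q(2)[of "\<lambda>\<mu>\<in>E_space M P. \<mu> A"] evaluation_in_unit_functionals[OF P A(1)] A(2) E QE[OF q(1)]
    by (simp add: K_def)
  with q(1) show "\<exists>q\<in>Q. \<forall>A\<in>sets M. measure p A \<ge> 2 * \<epsilon> \<longrightarrow> measure q A \<ge> \<epsilon> * \<delta> / 2"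
    by (auto simp: a_def)
qed

end
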